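(* Let $F: X\to[-\infty,\infty]$ and $G_*: Y\to[-\infty,\infty]$ be convex, proper, and lower semicontinuous; let $K\in C^1(X\times Y)$; and let both $J_X\in C(X)$ and $J_Y\in C(Y)$ be convex and Gâteaux-differentiable. Suppose for some $\gamma>0$ and $\hat u\in H^{-1}(0)$ that: (i) the second-order growth condition $(C^2)$ at $\bar u=\hat u$ holds within some $\Omega_{\hat u}\subset X\times Y$ with $\mathcal{G}(u,\hat u)\ge\gamma B^0(\hat u,u)$; and (ii) $B^0$ is elliptic within some $\Omega\subset X\times Y$ with $\hat u\in\Omega$. Let $\{u^{k+1}\}_{k\in\mathbb{N}}$ be generated by the PDBS for any initial $u^0$, and suppose $\{u^k\}_{k\in\mathbb{N}}\subset\Omega\cap\Omega_{\hat u}$. Then $B^0(\hat u,u^N)\to 0$ and $u^N\to\hat u$ at a linear rate as $N\to\infty$. In particular, if (in place of the bound $\mathcal{G}(u,\hat u)\ge\gamma B^0(\hat u,u)$ in (i)) $\mathcal{G}(u,\hat u)\ge\gamma\|u-\hat u\|_{X\times Y}^2$ for some $\gamma>0$, and $J^0$ is Lipschitz-continuously differentiable, then $u^N\to\hat u$ at a linear rate.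
   Context: All spaces are real; $X,Y$ are Banach spaces, $u=(x,y)\in X\times Y$, $u^k=(x^k,y^k)$, $\hat u=(\hat x,\hat y)$, etc. $\langle\cdot|\cdot\rangle$ is the dual pairing, $\partial$ the convex subdifferential, $D$ the Gâteaux derivative, $D_xK,D_yK$ the partial derivatives of $K$. The set-valued map $H: X\times Y\rightrightarrows X^*\times Y^*$ is $H(x,y)=\big(\partial F(x)+D_xK(x,y)\big)\times\big(\partial G_*(y)-D_yK(x,y)\big)$, and $H^{-1}(0)=\{u: 0\in H(u)\}$. For a Gâteaux-differentiable function $J$ the Bregman divergence is $B_J(z,x)=J(z)-J(x)-\langle DJ(x)|z-x\rangle$. Set $J^0(x,y)=J_X(x)+J_Y(y)-K(x,y)$ and $B^0=B_{J^0}$. $B^0$ is elliptic within $\Omega$ if for some $\epsilon>0$, $B^0(u',u)\ge\frac{\epsilon}{2}\|u'-u\|_{X\times Y}^2$ for all $u,u'\in\Omega$, where $\|(x,y)\|_{X\times Y}^2=\|x\|_X^2+\|y\|_Y^2$. PDBS (primal-dual Bregman-proximal splitting): given $u^0$, for each $k\in\mathbb{N}$ the iterate $u^{k+1}=(x^{k+1},y^{k+1})$ solves $$DJ_X(x^k)-D_xK(x^k,y^k)\in DJ_X(x^{k+1})+\partial F(x^{k+1}),$$ $$DJ_Y(y^k)-D_yK(x^k,y^k)\in DJ_Y(y^{k+1})+\partial G_*(y^{k+1})-2D_yK(x^{k+1},y^{k+1}).$$ Condition $(C^2)$ at $\bar u=(\bar x,\bar y)$ holds within $\Omega_{\bar u}$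 with $\mathcal{G}(\cdot,\bar u)$ if for all $u=(x,y)\in\Omega_{\bar u}$, $x^*\in\partial F(x)$, $y^*\in\partial G_*(y)$, $$\langle x^*+D_xK(x,y)|x-\bar x\rangle+\langle y^*-D_yK(x,y)|y-\bar y\rangle\ge\mathcal{G}(u,\bar u);$$ inequalities required of $\mathcal{G}(u,\hat u)$ are for all $u\in\Omega_{\hat u}$. "At a linear rate" means that the quantity ($B^0(\hat u,u^N)$, respectively $\|u^N-\hat u\|_{X\times Y}$) is bounded by $C\kappa^N$ for some $C\ge 0$ and $\kappa\in[0,1)$. *)

theory Defs
  imports "HOL-Analysis.Analysis"
begin

text \<open>
  The dual of a space \<open>'a\<close> is \<open>'a \<Rightarrow>\<^sub>L real\<close> with the operator norm, and the dual
  pairing of \<open>x\<^sup>*\<close> with \<open>x\<close> is \<open>blinfun_apply x\<^sup>* x\<close>. The norm of the library's product type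
  is \<open>norm (x, y) = sqrt ((norm x)\<^sup>2 + (norm y)\<^sup>2)\<close>.
\<close>

definition proper_fun :: "('a \<Rightarrow> ereal) \<Rightarrow> bool" where
  "proper_fun F \<longleftrightarrow> (\<forall>x. F x \<noteq> -\<infinity>) \<and> (\<exists>x. F x \<noteq> \<infinity>)"

text \<open>Convexity through the epigraph, which avoids sums of opposite infinities.\<close>

definition convex_ereal_fun :: "('a::real_vector \<Rightarrow> ereal) \<Rightarrow> bool" where
  "convex_ereal_fun F \<longleftrightarrow> convex {(x, t :: real). F x \<le> ereal t}"

definition lsc_fun :: "('a::topological_space \<Rightarrow> ereal) \<Rightarrow> bool" where
  "lsc_fun F \<longleftrightarrow> (\<forall>x. F x \<le> Liminf (nhds x) F)"

text \<open>The subdifferential is empty where \<open>F\<close> is not finite.\<close>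

definition subdiff :: "('a::real_normed_vector \<Rightarrow> ereal) \<Rightarrow> 'a \<Rightarrow> ('a \<Rightarrow>\<^sub>L real) set" where
  "subdiff F x = {p. \<bar>F x\<bar> \<noteq> \<infinity> \<and> (\<forall>z. F z \<ge> F x + ereal (blinfun_apply p (z - x)))}"

definition has_gateaux_derivative ::
  "('a::real_normed_vector \<Rightarrow> real) \<Rightarrow> ('a \<Rightarrow>\<^sub>L real) \<Rightarrow> 'a \<Rightarrow> bool" where
  "has_gateaux_derivative J A x \<longleftrightarrow>
     (\<forall>h. ((\<lambda>t. (J (x + t *\<^sub>R h) - J x) / t) \<longlongrightarrow> blinfun_apply A h) (at (0::real)))"

definition gateaux_differentiable :: "('a::real_normed_vector \<Rightarrow> real) \<Rightarrow> bool" where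
  "gateaux_differentiable J \<longleftrightarrow> (\<forall>x. \<exists>A. has_gateaux_derivative J A x)"

definition gateaux_deriv :: "('a::real_normed_vector \<Rightarrow> real) \<Rightarrow> 'a \<Rightarrow> ('a \<Rightarrow>\<^sub>L real)" where
  "gateaux_deriv J x = (THE A. has_gateaux_derivative J A x)"

lemma gateaux_deriv_eqI:
  assumes "has_gateaux_derivative J A x"
  shows "gateaux_deriv J x = A"
  unfolding gateaux_deriv_def
proof (rule the_equality)
  show "has_gateaux_derivative J A x" by (rule assms)
next
  fix B assume "has_gateaux_derivative J B x"
  then show "B = A"
    using assms unfolding has_gateaux_derivative_def
    by (intro blinfun_eqI) (meson tendsto_unique trivial_limit_at)
qed

lemma has_derivative_imp_has_gateaux_derivative:
  assumes "(J has_derivative blinfun_apply A) (at x)"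
  shows "has_gateaux_derivative J A x"
  unfolding has_gateaux_derivative_def
proof
  fix h
  have "((\<lambda>t. x + t *\<^sub>R h) has_derivative (\<lambda>t. t *\<^sub>R h)) (at (0::real))"
    by (auto intro!: derivative_eq_intros)
  then have "((\<lambda>t. J (x + t *\<^sub>R h)) has_derivative (\<lambda>t. blinfun_apply A (t *\<^sub>R h))) (at 0)"
    using has_derivative_compose[where g = J] assms by force
  then have "((\<lambda>t. J (x + t *\<^sub>R h)) has_field_derivative blinfun_apply A h) (at 0)"
    by (simp add: has_field_derivative_def blinfun.scaleR_right mult_commute_abs)
  then show "((\<lambda>t. (J (x + t *\<^sub>R h) - J x) / t) \<longlongrightarrow> blinfun_apply A h) (at 0)"
    by (simp add: DERIV_def)
qed

definition C1_fun :: "('a::real_normed_vector \<Rightarrow> real) \<Rightarrow> bool" where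
  "C1_fun K \<longleftrightarrow> (\<exists>K'. (\<forall>u. (K has_derivative blinfun_apply (K' u)) (at u)) \<and>
                    continuous_on UNIV K')"

definition lipschitz_continuously_differentiable :: "('a::real_normed_vector \<Rightarrow> real) \<Rightarrow> bool" where
  "lipschitz_continuously_differentiable J \<longleftrightarrow>
     gateaux_differentiable J \<and> (\<exists>L. L-lipschitz_on UNIV (gateaux_deriv J))"

definition Dx :: "('a::real_normed_vector \<times> 'b \<Rightarrow> real) \<Rightarrow> 'a \<times> 'b \<Rightarrow> ('a \<Rightarrow>\<^sub>L real)" where
  "Dx K u = gateaux_deriv (\<lambda>x. K (x, snd u)) (fst u)"

definition Dy :: "('a \<times> 'b::real_normed_vector \<Rightarrow> real) \<Rightarrow> 'a \<times> 'b \<Rightarrow> ('b \<Rightarrow>\<^sub>L real)" where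
  "Dy K u = gateaux_deriv (\<lambda>y. K (fst u, y)) (snd u)"

definition bregman :: "('a::real_normed_vector \<Rightarrow> real) \<Rightarrow> 'a \<Rightarrow> 'a \<Rightarrow> real" where
  "bregman J z x = J z - J x - blinfun_apply (gateaux_deriv J x) (z - x)"

definition J0 :: "('a \<Rightarrow> real) \<Rightarrow> ('b \<Rightarrow> real) \<Rightarrow> ('a \<times> 'b \<Rightarrow> real) \<Rightarrow> 'a \<times> 'b \<Rightarrow> real" where
  "J0 JX JY K u = JX (fst u) + JY (snd u) - K u"

definition elliptic_within :: "('a::real_normed_vector \<Rightarrow> 'a \<Rightarrow> real) \<Rightarrow> 'a set \<Rightarrow> bool" where
  "elliptic_within B \<Omega> \<longleftrightarrow>
     (\<exists>\<epsilon>>0. \<forall>u\<in>\<Omega>. \<forall>u'\<in>\<Omega>. B u' u \<ge> \<epsilon> / 2 * (norm (u' - u))\<^sup>2)"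

definition H_map ::
  "('a::real_normed_vector \<Rightarrow> ereal) \<Rightarrow> ('b::real_normed_vector \<Rightarrow> ereal) \<Rightarrow> ('a \<times> 'b \<Rightarrow> real) \<Rightarrow>
   'a \<times> 'b \<Rightarrow> (('a \<Rightarrow>\<^sub>L real) \<times> ('b \<Rightarrow>\<^sub>L real)) set" where
  "H_map F G K u =
     ((\<lambda>p. p + Dx K u) ` subdiff F (fst u)) \<times> ((\<lambda>q. q - Dy K u) ` subdiff G (snd u))"

definition H_zeros ::
  "('a::real_normed_vector \<Rightarrow> ereal) \<Rightarrow> ('b::real_normed_vector \<Rightarrow> ereal) \<Rightarrow> ('a \<times> 'b \<Rightarrow> real) \<Rightarrow>
   ('a \<times> 'b) set" where
  "H_zeros F G K = {u. 0 \<in> H_map F G K u}"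

definition PDBS ::
  "('a::real_normed_vector \<Rightarrow> ereal) \<Rightarrow> ('b::real_normed_vector \<Rightarrow> ereal) \<Rightarrow> ('a \<times> 'b \<Rightarrow> real) \<Rightarrow>
   ('a \<Rightarrow> real) \<Rightarrow> ('b \<Rightarrow> real) \<Rightarrow> (nat \<Rightarrow> 'a \<times> 'b) \<Rightarrow> bool" where
  "PDBS F G K JX JY u \<longleftrightarrow>
     (\<forall>k. gateaux_deriv JX (fst (u k)) - Dx K (u k)
            \<in> (\<lambda>p. gateaux_deriv JX (fst (u (Suc k))) + p) ` subdiff F (fst (u (Suc k))) \<and>
          gateaux_deriv JY (snd (u k)) - Dy K (u k)
            \<in> (\<lambda>q. gateaux_deriv JY (snd (u (Suc k))) + q - 2 *\<^sub>R Dy K (u (Suc k)))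
                ` subdiff G (snd (u (Suc k))))"

definition growth_C2 ::
  "('a::real_normed_vector \<Rightarrow> ereal) \<Rightarrow> ('b::real_normed_vector \<Rightarrow> ereal) \<Rightarrow> ('a \<times> 'b \<Rightarrow> real) \<Rightarrow>
   ('a \<times> 'b \<Rightarrow> 'a \<times> 'b \<Rightarrow> real) \<Rightarrow> 'a \<times> 'b \<Rightarrow> ('a \<times> 'b) set \<Rightarrow> bool" where
  "growth_C2 F G K \<G> ubar \<Omega> \<longleftrightarrow>
     (\<forall>u\<in>\<Omega>. \<forall>p\<in>subdiff F (fst u). \<forall>q\<in>subdiff G (snd u).
        blinfun_apply (p + Dx K u) (fst u - fst ubar) + blinfun_apply (q - Dy K u) (snd u - snd ubar)
          \<ge> \<G> u ubar)"

definition linear_rate :: "(nat \<Rightarrow> real) \<Rightarrow> bool" where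
  "linear_rate a \<longleftrightarrow> (\<exists>C\<ge>0. \<exists>\<kappa>. 0 \<le> \<kappa> \<and> \<kappa> < 1 \<and> (\<forall>N. \<bar>a N\<bar> \<le> C * \<kappa> ^ N))"

end

theory Submission
  imports Defs
begin

text \<open>
  The inclusions defining the iteration say precisely that \<open>DJ\<^sup>0(u\<^sup>k) - DJ\<^sup>0(u\<^sup>k\<^sup>+\<^sup>1)\<close> lies in
  \<open>H(u\<^sup>k\<^sup>+\<^sup>1)\<close>: the doubled term \<open>2 D\<^sub>yK\<close> corrects the sign of \<open>D\<^sub>yK\<close> in \<open>DJ\<^sup>0\<close>. Testing with
  \<open>u\<^sup>k\<^sup>+\<^sup>1 - uhat\<close>, the growth condition bounds the result from below and the three-point identity for
  Bregman divergences evaluates it, so that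
  \<open>\<G>(u\<^sup>k\<^sup>+\<^sup>1, uhat) + B\<^sup>0(uhat, u\<^sup>k\<^sup>+\<^sup>1) + B\<^sup>0(u\<^sup>k\<^sup>+\<^sup>1, u\<^sup>k) \<le> B\<^sup>0(uhat, u\<^sup>k)\<close>. Hence \<open>B\<^sup>0(uhat, u\<^sup>k)\<close>
  shrinks by the factor \<open>1 / (1 + \<gamma>)\<close> in each step. Under Lipschitz differentiability
  the mean value theorem gives \<open>B\<^sup>0(uhat, u) \<le> L \<parallel>u - uhat\<parallel>\<^sup>2\<close>, which reduces the second
  claim to the first.
\<close>

section \<open>Gateaux derivatives and their partial components\<close>

lemma has_gateaux_derivative_gateaux_deriv:
  assumes "gateaux_differentiable J"
  shows "has_gateaux_derivative J (gateaux_deriv J x) x"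
  using assms gateaux_deriv_eqI unfolding gateaux_differentiable_def by blast

text \<open>Reduces \<open>J\<close> to a function of one real variable, so that the mean value
  theorem applies along a segment. The difference quotient at \<open>t\<close> is the Gateaux
  quotient of \<open>J\<close> based at \<open>x + t *\<^sub>R h\<close>.\<close>

lemma has_gateaux_derivative_imp_DERIV_line:
  assumes "has_gateaux_derivative J A (x + t *\<^sub>R h)"
  shows "((\<lambda>t. J (x + t *\<^sub>R h)) has_real_derivative blinfun_apply A h) (at t)"
  using assms unfolding has_gateaux_derivative_def DERIV_def
  by (simp add: algebra_simps)

lemma has_gateaux_derivative_Pair1:
  assumes "has_gateaux_derivative K A (x, y)"
  shows "has_gateaux_derivative (\<lambda>x. K (x, y)) (A o\<^sub>L Blinfun (\<lambda>h. (h, 0))) x"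
proof -
  have bl: "bounded_linear (\<lambda>h. (h, 0))"
    by (intro bounded_linear_Pair bounded_linear_ident bounded_linear_zero)
  have "((\<lambda>t. (K ((x, y) + t *\<^sub>R (h, 0)) - K (x, y)) / t) \<longlongrightarrow> blinfun_apply A (h, 0)) (at 0)" for h
    using assms unfolding has_gateaux_derivative_def by blast
  then show ?thesis
    unfolding has_gateaux_derivative_def by (simp add: bounded_linear_Blinfun_apply[OF bl])
qed

lemma has_gateaux_derivative_Pair2:
  assumes "has_gateaux_derivative K A (x, y)"
  shows "has_gateaux_derivative (\<lambda>y. K (x, y)) (A o\<^sub>L Blinfun (\<lambda>h. (0, h))) y"
proof -
  have bl: "bounded_linear (\<lambda>h. (0, h))"
    by (intro bounded_linear_Pair bounded_linear_ident bounded_linear_zero)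
  have "((\<lambda>t. (K ((x, y) + t *\<^sub>R (0, h)) - K (x, y)) / t) \<longlongrightarrow> blinfun_apply A (0, h)) (at 0)" for h
    using assms unfolding has_gateaux_derivative_def by blast
  then show ?thesis
    unfolding has_gateaux_derivative_def by (simp add: bounded_linear_Blinfun_apply[OF bl])
qed

text \<open>Restricting \<open>A\<close> to each factor gives the partial derivatives, by uniqueness
  of Gateaux derivatives. Linearity of \<open>A\<close> on
  \<open>h = (fst h, 0) + (0, snd h)\<close> then adds them up.\<close>

lemma gateaux_derivative_eq_partials:
  assumes "has_gateaux_derivative K A u"
  shows "blinfun_apply A h = blinfun_apply (Dx K u) (fst h) + blinfun_apply (Dy K u) (snd h)"
proof -
  have bl1: "bounded_linear (\<lambda>h. (h, 0))" and bl2: "bounded_linear (\<lambda>h. (0, h))"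
    by (intro bounded_linear_Pair bounded_linear_ident bounded_linear_zero)+
  have A: "has_gateaux_derivative K A (fst u, snd u)"
    using assms by simp
  have "blinfun_apply (Dx K u) (fst h) = blinfun_apply A (fst h, 0)"
    by (simp add: Dx_def gateaux_deriv_eqI[OF has_gateaux_derivative_Pair1[OF A]]
        bounded_linear_Blinfun_apply[OF bl1])
  moreover have "blinfun_apply (Dy K u) (snd h) = blinfun_apply A (0, snd h)"
    by (simp add: Dy_def gateaux_deriv_eqI[OF has_gateaux_derivative_Pair2[OF A]]
        bounded_linear_Blinfun_apply[OF bl2])
  moreover have "blinfun_apply A h = blinfun_apply A (fst h, 0) + blinfun_apply A (0, snd h)"
    by (simp flip: blinfun.add_right)
  ultimately show ?thesis
    by simp
qed

text \<open>Puts the derivative into the componentwise form in which the PDBS inclusions are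
  stated.\<close>

lemma gateaux_deriv_J0_apply:
  assumes "gateaux_differentiable JX" "gateaux_differentiable JY" "gateaux_differentiable K"
  shows "blinfun_apply (gateaux_deriv (J0 JX JY K) u) h =
    blinfun_apply (gateaux_deriv JX (fst u) - Dx K u) (fst h) +
    blinfun_apply (gateaux_deriv JY (snd u) - Dy K u) (snd h)"
proof -
  \<comment> \<open>\<open>gateaux_deriv\<close> is a definite description, so a bounded functional
    on the product has to be exhibited; composing with the projections lifts the derivatives of
    \<open>JX\<close> and \<open>JY\<close> to it.\<close>
  define A where "A = (gateaux_deriv JX (fst u) o\<^sub>L Blinfun fst)
    + (gateaux_deriv JY (snd u) o\<^sub>L Blinfun snd) - gateaux_deriv K u"
  note K = has_gateaux_derivative_gateaux_deriv[OF assms(3), of u]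
  have A: "blinfun_apply A h = blinfun_apply (gateaux_deriv JX (fst u)) (fst h)
      + blinfun_apply (gateaux_deriv JY (snd u)) (snd h) - blinfun_apply (gateaux_deriv K u) h" for h
    by (simp add: A_def plus_blinfun.rep_eq minus_blinfun.rep_eq
        bounded_linear_Blinfun_apply bounded_linear_fst bounded_linear_snd)
  have "has_gateaux_derivative (J0 JX JY K) A u"
    unfolding has_gateaux_derivative_def
  proof
    fix h :: "'a \<times> 'b"
    have "((\<lambda>t. (JX (fst u + t *\<^sub>R fst h) - JX (fst u)) / t
          + (JY (snd u + t *\<^sub>R snd h) - JY (snd u)) / t
          - (K (u + t *\<^sub>R h) - K u) / t) \<longlongrightarrow> blinfun_apply A h) (at 0)"
      unfolding A using K assms(1,2)[THEN has_gateaux_derivative_gateaux_deriv]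
      unfolding has_gateaux_derivative_def by (intro tendsto_intros) blast+
    then show "((\<lambda>t. (J0 JX JY K (u + t *\<^sub>R h) - J0 JX JY K u) / t) \<longlongrightarrow> blinfun_apply A h) (at 0)"
      by (simp add: J0_def diff_divide_distrib add_divide_distrib algebra_simps)
  qed
  from gateaux_deriv_eqI[OF this] show ?thesis
    by (simp add: A gateaux_derivative_eq_partials[OF K] minus_blinfun.rep_eq)
qed

section \<open>Bregman divergences\<close>

lemma bregman_three_point:
  "blinfun_apply (gateaux_deriv J v - gateaux_deriv J w) (w - z) =
    bregman J z v - bregman J z w - bregman J w v"
  by (simp add: bregman_def minus_blinfun.rep_eq blinfun.diff_right)

text \<open>By the mean value theorem the divergence is a difference of derivatives at two points of
  the segment from \<open>x\<close> to \<open>z\<close>, tested with \<open>z - x\<close>. This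
  yields the factor \<open>L\<close> rather than the sharper \<open>L / 2\<close> of the integral
  form; any constant serves for a linear rate.\<close>

lemma bregman_le_lipschitz:
  assumes "gateaux_differentiable J" and L: "L-lipschitz_on UNIV (gateaux_deriv J)"
  shows "bregman J z x \<le> L * (norm (x - z))\<^sup>2"
proof -
  define h where "h = z - x"
  have "((\<lambda>t. J (x + t *\<^sub>R h)) has_real_derivative
      blinfun_apply (gateaux_deriv J (x + t *\<^sub>R h)) h) (at t)" for t
    by (intro has_gateaux_derivative_imp_DERIV_line has_gateaux_derivative_gateaux_deriv assms)
  from MVT2[OF zero_less_one this]
  obtain t :: real where t: "0 < t" "t < 1"
    and mv: "J z - J x = blinfun_apply (gateaux_deriv J (x + t *\<^sub>R h)) h"
    by (auto simp: h_def)
  have "bregman J z x = blinfun_apply (gateaux_deriv J (x + t *\<^sub>R h) - gateaux_deriv J x) h"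
    by (simp add: bregman_def mv minus_blinfun.rep_eq flip: h_def)
  also have "\<dots> \<le> norm (gateaux_deriv J (x + t *\<^sub>R h) - gateaux_deriv J x) * norm h"
    by (metis abs_le_D1 norm_blinfun real_norm_def)
  also have "\<dots> \<le> (L * norm h) * norm h"
  proof (rule mult_right_mono)
    have "norm (gateaux_deriv J (x + t *\<^sub>R h) - gateaux_deriv J x) \<le> L * (t * norm h)"
      using lipschitz_onD[OF L UNIV_I UNIV_I, of "x + t *\<^sub>R h" x] t by (simp add: dist_norm)
    also have "\<dots> \<le> L * norm h"
      using t lipschitz_on_nonneg[OF L] by (intro mult_left_mono mult_left_le_one_le) auto
    finally show "norm (gateaux_deriv J (x + t *\<^sub>R h) - gateaux_deriv J x) \<le> L * norm h" .
  qed simp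
  finally show ?thesis
    by (simp add: h_def power2_eq_square norm_minus_commute mult.assoc)
qed

section \<open>Linear rates of real sequences\<close>

lemma linear_rateI:
  assumes "0 \<le> C" "0 \<le> \<kappa>" "\<kappa> < 1" "\<And>N. \<bar>a N\<bar> \<le> C * \<kappa> ^ N"
  shows "linear_rate a"
  using assms unfolding linear_rate_def by blast

lemma linear_rate_imp_tendsto_0:
  assumes "linear_rate a"
  shows "a \<longlonglongrightarrow> 0"
proof -
  obtain C \<kappa> where \<kappa>: "0 \<le> \<kappa>" "\<kappa> < 1" and le: "\<And>N. \<bar>a N\<bar> \<le> C * \<kappa> ^ N"
    using assms unfolding linear_rate_def by blast
  have "(\<lambda>N. C * \<kappa> ^ N) \<longlonglongrightarrow> C * 0"
    using \<kappa> by (intro tendsto_intros LIMSEQ_realpow_zero)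
  then show ?thesis
    by (intro Lim_null_comparison[of a]) (use le in auto)
qed

lemma linear_rate_of_contraction:
  fixes a :: "nat \<Rightarrow> real"
  assumes "0 < \<gamma>" "\<And>N. 0 \<le> a N" "\<And>N. (1 + \<gamma>) * a (Suc N) \<le> a N"
  shows "linear_rate a"
proof (rule linear_rateI)
  \<comment> \<open>The constant is the initial value, and the ratio is below 1 because
    \<open>\<gamma>\<close> is positive.\<close>
  show "\<bar>a N\<bar> \<le> a 0 * (1 / (1 + \<gamma>)) ^ N" for N
  proof (induction N)
    case 0
    then show ?case using assms(2)[of 0] by simp
  next
    case (Suc N)
    have "a (Suc N) \<le> a N * (1 / (1 + \<gamma>))"
      using assms(3)[of N] assms(1) by (simp add: field_simps)
    also have "\<dots> \<le> a 0 * (1 / (1 + \<gamma>)) ^ N * (1 / (1 + \<gamma>))"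
      using Suc assms(1) by (intro mult_right_mono) auto
    finally show ?case using assms(2)[of "Suc N"] by (simp add: mult_ac)
  qed
qed (use assms(1) assms(2)[of 0] in auto)

text \<open>Transfers a rate from divergences to distances. Taking square roots replaces the ratio
  \<open>\<kappa>\<close> by \<open>sqrt \<kappa>\<close>, which is still below 1.\<close>

lemma linear_rate_of_square_le:
  assumes "linear_rate a" "0 \<le> c" "\<And>N. (b N)\<^sup>2 \<le> c * a N"
  shows "linear_rate b"
proof -
  obtain C \<kappa> where C: "0 \<le> C" and \<kappa>: "0 \<le> \<kappa>" "\<kappa> < 1" and le: "\<And>N. \<bar>a N\<bar> \<le> C * \<kappa> ^ N"
    using assms(1) unfolding linear_rate_def by blast
  show ?thesis
  proof (rule linear_rateI)
    show "\<bar>b N\<bar> \<le> sqrt (c * C) * sqrt \<kappa> ^ N" for N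
    proof -
      have "(b N)\<^sup>2 \<le> c * (C * \<kappa> ^ N)"
        using assms(2) assms(3)[of N] le[of N] by (meson abs_le_D1 mult_left_mono order_trans)
      then have "sqrt ((b N)\<^sup>2) \<le> sqrt (c * (C * \<kappa> ^ N))"
        by (rule real_sqrt_le_mono)
      then show ?thesis
        unfolding real_sqrt_abs by (simp add: real_sqrt_mult real_sqrt_power mult.assoc)
    qed
  qed (use C \<kappa> assms(2) in auto)
qed

section \<open>The iteration and its convergence\<close>

lemma PDBS_growth_step:
  assumes "gateaux_differentiable JX" "gateaux_differentiable JY" "gateaux_differentiable K"
    and "growth_C2 F G K \<G> uhat S" "PDBS F G K JX JY u" "u (Suc k) \<in> S"
  shows "\<G> (u (Suc k)) uhat + bregman (J0 JX JY K) uhat (u (Suc k))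
      + bregman (J0 JX JY K) (u (Suc k)) (u k) \<le> bregman (J0 JX JY K) uhat (u k)"
proof -
  let ?v = "u (Suc k)" and ?J = "J0 JX JY K"
  obtain p where p: "p \<in> subdiff F (fst ?v)"
    "gateaux_deriv JX (fst (u k)) - Dx K (u k) = gateaux_deriv JX (fst ?v) + p"
    using assms(5) unfolding PDBS_def by blast
  obtain q where q: "q \<in> subdiff G (snd ?v)"
    "gateaux_deriv JY (snd (u k)) - Dy K (u k) =
      gateaux_deriv JY (snd ?v) + q - 2 *\<^sub>R Dy K ?v"
    using assms(5) unfolding PDBS_def by blast
  have "\<G> ?v uhat \<le> blinfun_apply (p + Dx K ?v) (fst ?v - fst uhat)
      + blinfun_apply (q - Dy K ?v) (snd ?v - snd uhat)"
    using assms(4,6) p(1) q(1) unfolding growth_C2_def by blast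
  \<comment> \<open>Subtracting the components of the derivative of \<open>?J\<close> at
    \<open>?v\<close> adds one \<open>Dx K ?v\<close> to \<open>p\<close> and one
    \<open>Dy K ?v\<close> to \<open>q - 2 *\<^sub>R Dy K ?v\<close>, leaving exactly
    \<open>p + Dx K ?v\<close> and \<open>q - Dy K ?v\<close>.\<close>
  also have "\<dots> = blinfun_apply (gateaux_deriv ?J (u k) - gateaux_deriv ?J ?v) (?v - uhat)"
    unfolding minus_blinfun.rep_eq gateaux_deriv_J0_apply[OF assms(1-3)] p(2) q(2)
    by (simp add: plus_blinfun.rep_eq minus_blinfun.rep_eq scaleR_blinfun.rep_eq)
  finally show ?thesis
    \<comment> \<open>Here the old iterate is \<open>v\<close>, the new one \<open>w\<close> and the
      solution \<open>z\<close> of the three-point identity.\<close>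
    unfolding bregman_three_point by simp
qed

theorem theorem4:
  fixes F :: "'a::banach \<Rightarrow> ereal" and G :: "'b::banach \<Rightarrow> ereal"
    and K :: "'a \<times> 'b \<Rightarrow> real" and JX :: "'a \<Rightarrow> real" and JY :: "'b \<Rightarrow> real"
    and \<G> :: "'a \<times> 'b \<Rightarrow> 'a \<times> 'b \<Rightarrow> real"
    and uhat :: "'a \<times> 'b" and \<Omega> \<Omega>hat :: "('a \<times> 'b) set"
    and u :: "nat \<Rightarrow> 'a \<times> 'b"
  defines "B0 \<equiv> bregman (J0 JX JY K)"
  assumes "convex_ereal_fun F" "proper_fun F" "lsc_fun F"
    and "convex_ereal_fun G" "proper_fun G" "lsc_fun G"
    and "C1_fun K"
    and "continuous_on UNIV JX" "convex_on UNIV JX" "gateaux_differentiable JX"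
    and "continuous_on UNIV JY" "convex_on UNIV JY" "gateaux_differentiable JY"
    and "uhat \<in> H_zeros F G K"
    and "growth_C2 F G K \<G> uhat \<Omega>hat"
    and "uhat \<in> \<Omega>" "elliptic_within B0 \<Omega>"
    and "PDBS F G K JX JY u"
    and "range u \<subseteq> \<Omega> \<inter> \<Omega>hat"
  shows "((\<exists>\<gamma>>0. \<forall>v\<in>\<Omega>hat. \<G> v uhat \<ge> \<gamma> * B0 uhat v) \<longrightarrow>
            (\<lambda>N. B0 uhat (u N)) \<longlonglongrightarrow> 0 \<and> linear_rate (\<lambda>N. B0 uhat (u N)) \<and>
            u \<longlonglongrightarrow> uhat \<and> linear_rate (\<lambda>N. norm (u N - uhat)))
       \<and> ((\<exists>\<gamma>>0. \<forall>v\<in>\<Omega>hat. \<G> v uhat \<ge> \<gamma> * (norm (v - uhat))\<^sup>2) \<and>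
            lipschitz_continuously_differentiable (J0 JX JY K) \<longrightarrow>
            u \<longlonglongrightarrow> uhat \<and> linear_rate (\<lambda>N. norm (u N - uhat)))"
proof -
  have K: "gateaux_differentiable K"
    using \<open>C1_fun K\<close> has_derivative_imp_has_gateaux_derivative
    unfolding C1_fun_def gateaux_differentiable_def by blast
  obtain \<epsilon> where "\<epsilon> > 0"
    and ell: "\<And>v w. v \<in> \<Omega> \<Longrightarrow> w \<in> \<Omega> \<Longrightarrow> \<epsilon> / 2 * (norm (w - v))\<^sup>2 \<le> B0 w v"
    using \<open>elliptic_within B0 \<Omega>\<close> unfolding elliptic_within_def by blast
  have u: "u N \<in> \<Omega>" "u N \<in> \<Omega>hat" for N
    using \<open>range u \<subseteq> \<Omega> \<inter> \<Omega>hat\<close> by auto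
  have B0_nonneg: "0 \<le> B0 w v" if "v \<in> \<Omega>" "w \<in> \<Omega>" for v w
    using \<open>\<epsilon> > 0\<close> by (intro order_trans[OF _ ell[OF that]]) simp
  have main: "(\<lambda>N. B0 uhat (u N)) \<longlonglongrightarrow> 0 \<and> linear_rate (\<lambda>N. B0 uhat (u N)) \<and>
            u \<longlonglongrightarrow> uhat \<and> linear_rate (\<lambda>N. norm (u N - uhat))"
    if "\<gamma> > 0" and growth: "\<forall>v\<in>\<Omega>hat. \<G> v uhat \<ge> \<gamma> * B0 uhat v" for \<gamma>
  proof -
    have B0_rate: "linear_rate (\<lambda>N. B0 uhat (u N))"
    proof (rule linear_rate_of_contraction[OF \<open>\<gamma> > 0\<close>])
      show "0 \<le> B0 uhat (u N)" for N
        using u \<open>uhat \<in> \<Omega>\<close> by (intro B0_nonneg)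
      show "(1 + \<gamma>) * B0 uhat (u (Suc N)) \<le> B0 uhat (u N)" for N
      proof -
        have "\<gamma> * B0 uhat (u (Suc N)) \<le> \<G> (u (Suc N)) uhat"
          using growth u(2) by blast
        moreover have "\<G> (u (Suc N)) uhat + B0 uhat (u (Suc N)) + B0 (u (Suc N)) (u N) \<le> B0 uhat (u N)"
          unfolding B0_def
          by (rule PDBS_growth_step[OF \<open>gateaux_differentiable JX\<close> \<open>gateaux_differentiable JY\<close> K
            \<open>growth_C2 F G K \<G> uhat \<Omega>hat\<close> \<open>PDBS F G K JX JY u\<close> u(2)])
        \<comment> \<open>Both iterates lie in \<open>\<Omega>\<close>, so ellipticity allows
          dropping the divergence between them.\<close>
        moreover have "0 \<le> B0 (u (Suc N)) (u N)"
          using u(1) by (intro B0_nonneg)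
        ultimately show ?thesis
          by (simp add: distrib_right)
      qed
    qed
    have norm_rate: "linear_rate (\<lambda>N. norm (u N - uhat))"
    proof (rule linear_rate_of_square_le[OF B0_rate, of "2 / \<epsilon>"])
      \<comment> \<open>Ellipticity with base point \<open>u N\<close>, solved for the squared
        distance; hence the factor \<open>2 / \<epsilon>\<close>.\<close>
      show "(norm (u N - uhat))\<^sup>2 \<le> 2 / \<epsilon> * B0 uhat (u N)" for N
        using ell[OF u(1) \<open>uhat \<in> \<Omega>\<close>, of N] \<open>\<epsilon> > 0\<close> by (simp add: field_simps norm_minus_commute)
    qed (use \<open>\<epsilon> > 0\<close> in auto)
    have "u \<longlonglongrightarrow> uhat"
      using linear_rate_imp_tendsto_0[OF norm_rate]
      by (simp add: tendsto_norm_zero_iff LIM_zero_iff)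
    with B0_rate norm_rate linear_rate_imp_tendsto_0[OF B0_rate] show ?thesis
      by blast
  qed
  have "\<exists>\<gamma>>0. \<forall>v\<in>\<Omega>hat. \<G> v uhat \<ge> \<gamma> * B0 uhat v"
    if "\<gamma> > 0" and growth: "\<forall>v\<in>\<Omega>hat. \<G> v uhat \<ge> \<gamma> * (norm (v - uhat))\<^sup>2"
      and lip: "lipschitz_continuously_differentiable (J0 JX JY K)" for \<gamma>
  proof -
    obtain L where L: "L-lipschitz_on UNIV (gateaux_deriv (J0 JX JY K))"
      and J0: "gateaux_differentiable (J0 JX JY K)"
      using lip unfolding lipschitz_continuously_differentiable_def by blast
    note L0 = lipschitz_on_nonneg[OF L]
    \<comment> \<open>The new growth constant divides by \<open>L + 1\<close> instead of
      \<open>L\<close>, since the Lipschitz constant may be 0.\<close>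
    have "\<gamma> / (L + 1) * B0 uhat v \<le> \<gamma> * (norm (v - uhat))\<^sup>2" for v
    proof -
      have "B0 uhat v \<le> (L + 1) * (norm (v - uhat))\<^sup>2"
        using bregman_le_lipschitz[OF J0 L, of uhat v] unfolding B0_def
        by (simp add: distrib_right add_increasing2)
      then have "\<gamma> / (L + 1) * B0 uhat v \<le> \<gamma> / (L + 1) * ((L + 1) * (norm (v - uhat))\<^sup>2)"
        using \<open>\<gamma> > 0\<close> L0 by (intro mult_left_mono) auto
      then show ?thesis
        using L0 by simp
    qed
    then have "\<forall>v\<in>\<Omega>hat. \<gamma> / (L + 1) * B0 uhat v \<le> \<G> v uhat"
      using growth order_trans by blast
    moreover have "\<gamma> / (L + 1) > 0"
      using \<open>\<gamma> > 0\<close> L0 by simp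
    ultimately show ?thesis
      by blast
  qed
  with main show ?thesis
    by blast
qed

end
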